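(* Let $f:\mathcal X\times\mathcal Y\to\{0,1\}^k$ be a total function, where each output string is identified with the nonnegative integer it represents in binary, and let $M_f=(f(x,y))_{x\in\mathcal X,y\in\mathcal Y}$ be the corresponding real matrix. Then $$D^{\mathrm{op}}(f)=D^{\mathrm{loc}}(f)\ge D^{\mathrm{uni}}(f)\ge D^{\mathrm{oot}}(f)\ge\log\operatorname{rank}(M_f),$$ $$D^{\mathrm{spt}}(f)\ge\log\operatorname{rank}(M_f)-1,\qquad D^{\mathrm{xor}}(f)\ge\log\operatorname{rank}(M_f)-\log(k+1).$$
   Context: Deterministic two-party communication: Alice receives $x$, Bob $y$; they exchange bits according to a protocol tree; $t_\pi$ is the transcript; cost is the maximum number of bits exchanged. Output models (zero error): open — there is a map $O(t_\pi)$ equal to $f(x,y)$; local — maps $O_A(t_\pi,x)$ and $O_B(t_\pi,y)$ both equal $f(x,y)$; Alice (resp. Bob) — $O_A(t_\pi,x)=f(x,y)$ (resp. $O_B(t_\pi,y)=f(x,y)$); one-out-of-two — $O_A,O_B$ take values in $\{0,1\}^k\cup\{\top\}$ ($\top$ a special symbol) and $(O_A,O_B)\in\{(f(x,y),\top),(\top,f(x,y))\}$; split — $O_A,O_B\in\{0,1,*\}^k$ and $O_A\bowtie O_B=f(x,y)$, where $(a\bowtie b)_i=a_i$ if $b_i=*$, $b_i$ if $a_i=*$, and $*$ otherwise; XOR — $O_A,O_B\in\{0,1\}^k$ and $O_A\oplus O_B=f(x,y)$ (bitwise XOR). $D^{\mathrm{op}},D^{\mathrm{loc}},D^{\mathrm{oot}},D^{\mathrm{spt}},D^{\mathrm{xor}}$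 are the minimum costs of deterministic protocols in the respective models, $D^{\mathrm{uni}}(f)=\min(D^{A}(f),D^{B}(f))$ with $D^A,D^B$ for the Alice and Bob models. Rank is over $\mathbb R$; logarithms are base 2. *)

theory Defs
  imports "HOL-Analysis.Analysis"
begin

datatype ('a, 'b) protocol =
    Leaf
  | Alice "'a \<Rightarrow> bool" "('a, 'b) protocol" "('a, 'b) protocol"
  | Bob "'b \<Rightarrow> bool" "('a, 'b) protocol" "('a, 'b) protocol"

primrec transcript :: "('a, 'b) protocol \<Rightarrow> 'a \<Rightarrow> 'b \<Rightarrow> bool list" where
  "transcript Leaf x y = []"
| "transcript (Alice m l r) x y = m x # (if m x then transcript r x y else transcript l x y)"
| "transcript (Bob m l r) x y = m y # (if m y then transcript r x y else transcript l x y)"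

definition cost :: "('a::finite, 'b::finite) protocol \<Rightarrow> nat" where
  "cost p = Max {length (transcript p x y) | x y. True}"

text \<open>Elements of \<open>{0,1}\<^sup>k\<close> are Boolean lists of length \<open>k\<close>, most significant bit first.
  In the first five models a correct output equals the value of \<open>f\<close>, so its length needs no separate
  constraint.\<close>

definition open_model :: "('a \<Rightarrow> 'b \<Rightarrow> bool list) \<Rightarrow> ('a, 'b) protocol \<Rightarrow> bool" where
  "open_model f p \<longleftrightarrow> (\<exists>out. \<forall>x y. out (transcript p x y) = f x y)"

definition local_model :: "('a \<Rightarrow> 'b \<Rightarrow> bool list) \<Rightarrow> ('a, 'b) protocol \<Rightarrow> bool" where
  "local_model f p \<longleftrightarrow> (\<exists>outA outB. \<forall>x y.
     outA (transcript p x y) x = f x y \<and> outB (transcript p x y) y = f x y)"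

definition alice_model :: "('a \<Rightarrow> 'b \<Rightarrow> bool list) \<Rightarrow> ('a, 'b) protocol \<Rightarrow> bool" where
  "alice_model f p \<longleftrightarrow> (\<exists>outA. \<forall>x y. outA (transcript p x y) x = f x y)"

definition bob_model :: "('a \<Rightarrow> 'b \<Rightarrow> bool list) \<Rightarrow> ('a, 'b) protocol \<Rightarrow> bool" where
  "bob_model f p \<longleftrightarrow> (\<exists>outB. \<forall>x y. outB (transcript p x y) y = f x y)"

text \<open>\<open>None\<close> is the symbol \<open>\<top>\<close>.\<close>

definition oot_model :: "('a \<Rightarrow> 'b \<Rightarrow> bool list) \<Rightarrow> ('a, 'b) protocol \<Rightarrow> bool" where
  "oot_model f p \<longleftrightarrow> (\<exists>outA outB. \<forall>x y.
     (outA (transcript p x y) x, outB (transcript p x y) y)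
       \<in> {(Some (f x y), None), (None, Some (f x y))})"

text \<open>In the split model \<open>None\<close> is the symbol \<open>*\<close> at a single position.\<close>

fun weave_bit :: "bool option \<Rightarrow> bool option \<Rightarrow> bool option" where
  "weave_bit a None = a"
| "weave_bit None b = b"
| "weave_bit (Some _) (Some _) = None"

text \<open>The length constraints matter in the last two models, because \<open>map2\<close> truncates to
  the shorter list.\<close>

definition split_model :: "nat \<Rightarrow> ('a \<Rightarrow> 'b \<Rightarrow> bool list) \<Rightarrow> ('a, 'b) protocol \<Rightarrow> bool" where
  "split_model k f p \<longleftrightarrow> (\<exists>outA outB.
     (\<forall>t x. length (outA t x) = k) \<and> (\<forall>t y. length (outB t y) = k) \<and>
     (\<forall>x y. map2 weave_bit (outA (transcript p x y) x) (outB (transcript p x y) y)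
        = map Some (f x y)))"

definition xor_model :: "nat \<Rightarrow> ('a \<Rightarrow> 'b \<Rightarrow> bool list) \<Rightarrow> ('a, 'b) protocol \<Rightarrow> bool" where
  "xor_model k f p \<longleftrightarrow> (\<exists>(outA :: bool list \<Rightarrow> 'a \<Rightarrow> bool list) (outB :: bool list \<Rightarrow> 'b \<Rightarrow> bool list).
     (\<forall>t x. length (outA t x) = k) \<and> (\<forall>t y. length (outB t y) = k) \<and>
     (\<forall>x y. map2 (\<noteq>) (outA (transcript p x y) x) (outB (transcript p x y) y) = f x y))"

text \<open>Finite input types guarantee that each model admits a protocol, so the minimum below is
  attained.\<close>

definition min_cost :: "(('a::finite, 'b::finite) protocol \<Rightarrow> bool) \<Rightarrow> nat" where
  "min_cost P = (LEAST c. \<exists>p. P p \<and> cost p = c)"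

definition D_op :: "('a::finite \<Rightarrow> 'b::finite \<Rightarrow> bool list) \<Rightarrow> nat" where
  "D_op f = min_cost (open_model f)"

definition D_loc :: "('a::finite \<Rightarrow> 'b::finite \<Rightarrow> bool list) \<Rightarrow> nat" where
  "D_loc f = min_cost (local_model f)"

definition D_A :: "('a::finite \<Rightarrow> 'b::finite \<Rightarrow> bool list) \<Rightarrow> nat" where
  "D_A f = min_cost (alice_model f)"

definition D_B :: "('a::finite \<Rightarrow> 'b::finite \<Rightarrow> bool list) \<Rightarrow> nat" where
  "D_B f = min_cost (bob_model f)"

definition D_uni :: "('a::finite \<Rightarrow> 'b::finite \<Rightarrow> bool list) \<Rightarrow> nat" where
  "D_uni f = min (D_A f) (D_B f)"

definition D_oot :: "('a::finite \<Rightarrow> 'b::finite \<Rightarrow> bool list) \<Rightarrow> nat" where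
  "D_oot f = min_cost (oot_model f)"

definition D_spt :: "nat \<Rightarrow> ('a::finite \<Rightarrow> 'b::finite \<Rightarrow> bool list) \<Rightarrow> nat" where
  "D_spt k f = min_cost (split_model k f)"

definition D_xor :: "nat \<Rightarrow> ('a::finite \<Rightarrow> 'b::finite \<Rightarrow> bool list) \<Rightarrow> nat" where
  "D_xor k f = min_cost (xor_model k f)"

text \<open>\<open>horner_sum\<close> expects the least significant bit first.\<close>

definition bits_to_nat :: "bool list \<Rightarrow> nat" where
  "bits_to_nat s = horner_sum of_bool 2 (rev s)"

definition comm_matrix :: "('a::finite \<Rightarrow> 'b::finite \<Rightarrow> bool list) \<Rightarrow> real ^ 'b ^ 'a" where
  "comm_matrix f = (\<chi> x y. real (bits_to_nat (f x y)))"

end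

theory Submission
  imports Defs
begin

text \<open>The inputs that share a transcript form a combinatorial rectangle, and a protocol of cost
  \<open>c\<close> has at most \<open>2\<^sup>c\<close> transcripts. In the local model \<open>f\<close> depends on each rectangle
  only on \<open>x\<close> and only on \<open>y\<close>, so it is constant there. In the other models \<open>M\<^sub>f\<close>
  restricted to a rectangle has small rank: 1 in the one-out-of-two model, because one player gives
  the output on the whole rectangle; 2 in the split model, because the entry is the sum of a
  contribution of Alice and one of Bob; and \<open>k + 1\<close> in the XOR model, because
  \<open>a \<oplus> b = 1/2 - (1 - 2 a) (1 - 2 b) / 2\<close> lets all positions share one constant term.\<close>

section \<open>Transcripts: rectangles and counting\<close>

text \<open>Each bit of \<open>t\<close> is computed from one player's input alone: \<open>x\<close>
  meets Alice's conditions along the path and \<open>y'\<close> meets Bob's.\<close>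

lemma transcript_rectangle:
  assumes "transcript p x y = t" and "transcript p x' y' = t"
  shows "transcript p x y' = t"
  using assms by (induction p arbitrary: t) (auto split: if_splits)

text \<open>The restriction to \<open>X \<times> Y\<close> serves the induction: a subtree is
  charged only for inputs that reach it, so an unreachable deep branch does no harm.\<close>

lemma card_transcripts_le:
  fixes p :: "('a::finite, 'b::finite) protocol"
  assumes "\<And>x y. x \<in> X \<Longrightarrow> y \<in> Y \<Longrightarrow> length (transcript p x y) \<le> c"
  shows "card ((\<lambda>(x, y). transcript p x y) ` (X \<times> Y)) \<le> 2 ^ c"
  using assms
proof (induction p arbitrary: X Y c)
  case Leaf
  have "card ((\<lambda>(x, y). transcript (Leaf :: ('a, 'b) protocol) x y) ` (X \<times> Y)) \<le> card {[] :: bool list}"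
    by (intro card_mono) auto
  then show ?case
    using le_trans by fastforce
next
  case (Alice m l r)
  let ?T = "\<lambda>p X Y. (\<lambda>(x, y). transcript p x y) ` (X \<times> Y)"
  show ?case
  proof (cases "X \<times> Y = {}")
    case False
    \<comment> \<open>Some input reaches this node and a bit is sent, so the bound cannot be
      0.\<close>
    then obtain c' where c: "c = Suc c'"
      using Alice.prems by (cases c) force+
    let ?L = "?T l (X \<inter> {x. \<not> m x}) Y" and ?R = "?T r (X \<inter> {x. m x}) Y"
    have "?T (Alice m l r) X Y \<subseteq> (#) False ` ?L \<union> (#) True ` ?R"
      by (auto simp: image_iff Bex_def) blast+
    then have "card (?T (Alice m l r) X Y) \<le> card ((#) False ` ?L \<union> (#) True ` ?R)"
      by (intro card_mono) auto
    also have "\<dots> \<le> card ?L + card ?R"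
      by (intro card_Un_le[THEN le_trans] add_mono card_image_le) auto
    also have "\<dots> \<le> 2 ^ c' + 2 ^ c'"
      using Alice.prems unfolding c by (intro add_mono Alice.IH) force+
    finally show ?thesis
      using c by simp
  qed auto
next
  case (Bob m l r)
  let ?T = "\<lambda>p X Y. (\<lambda>(x, y). transcript p x y) ` (X \<times> Y)"
  show ?case
  proof (cases "X \<times> Y = {}")
    case False
    then obtain c' where c: "c = Suc c'"
      using Bob.prems by (cases c) force+
    let ?L = "?T l X (Y \<inter> {y. \<not> m y})" and ?R = "?T r X (Y \<inter> {y. m y})"
    have "?T (Bob m l r) X Y \<subseteq> (#) False ` ?L \<union> (#) True ` ?R"
      by (auto simp: image_iff Bex_def) blast+
    then have "card (?T (Bob m l r) X Y) \<le> card ((#) False ` ?L \<union> (#) True ` ?R)"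
      by (intro card_mono) auto
    also have "\<dots> \<le> card ?L + card ?R"
      by (intro card_Un_le[THEN le_trans] add_mono card_image_le) auto
    also have "\<dots> \<le> 2 ^ c' + 2 ^ c'"
      using Bob.prems unfolding c by (intro add_mono Bob.IH) force+
    finally show ?thesis
      using c by simp
  qed auto
qed

lemma length_transcript_le_cost: "length (transcript p x y) \<le> cost p"
proof -
  have "{length (transcript p x y) | x y. True} = range (\<lambda>(x, y). length (transcript p x y))"
    by auto
  then have "finite {length (transcript p x y) | x y. True}"
    by simp
  then show ?thesis
    unfolding cost_def by (intro Max_ge) auto
qed

lemma card_range_transcript_le: "card (range (\<lambda>(x, y). transcript p x y)) \<le> 2 ^ cost p"
  using card_transcripts_le[of UNIV UNIV p, OF length_transcript_le_cost] by simp

section \<open>Rank of sums of products\<close>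

text \<open>The range of \<open>M\<close> lies in the span of the \<open>u i\<close>: the
  coefficient of \<open>u i\<close> in \<open>M *v z\<close> is the inner product of
  \<open>v i\<close> with \<open>z\<close>.\<close>

lemma rank_sum_outer_le:
  fixes M :: "real ^ 'b::finite ^ 'a::finite"
  assumes fin: "finite I" and M: "\<And>x y. M $ x $ y = (\<Sum>i\<in>I. u i x * v i y)"
  shows "rank M \<le> card I"
proof -
  let ?U = "(\<lambda>i. \<chi> x. u i x) ` I"
  have "M *v z \<in> span ?U" for z
  proof -
    have "(M *v z) $ x = (\<Sum>i\<in>I. (\<Sum>y\<in>UNIV. v i y * z $ y) * u i x)" for x
      unfolding matrix_vector_mult_def M vec_lambda_beta sum_distrib_right
      by (subst sum.swap) (simp add: algebra_simps)
    then have "M *v z = (\<Sum>i\<in>I. (\<Sum>y\<in>UNIV. v i y * z $ y) *\<^sub>R (\<chi> x. u i x))"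
      by (simp add: vec_eq_iff)
    then show ?thesis
      by (simp only:) (intro span_sum span_mul span_base imageI)
  qed
  then have "dim (range ((*v) M)) \<le> card ?U"
    by (intro dim_le_card) (auto simp: fin)
  also have "\<dots> \<le> card I"
    by (rule card_image_le[OF fin])
  finally show ?thesis
    by (simp add: rank_dim_range)
qed

text \<open>The factors may change with the transcript. Each rectangle contributes \<open>r\<close>
  products, extended by zero outside it, and there are at most \<open>2 ^ cost p\<close>
  rectangles.\<close>

lemma rank_protocol_le:
  fixes M :: "real ^ 'b::finite ^ 'a::finite" and p :: "('a, 'b) protocol"
  assumes M: "\<And>x y. M $ x $ y = (\<Sum>i<r. u (transcript p x y) i x * v (transcript p x y) i y)"
  shows "rank M \<le> r * 2 ^ cost p"
proof -
  let ?T = "range (\<lambda>(x, y). transcript p x y)"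
  define A where "A t x \<longleftrightarrow> (\<exists>y. transcript p x y = t)" for t x
  define B where "B t y \<longleftrightarrow> (\<exists>x. transcript p x y = t)" for t y
  \<comment> \<open>\<open>A t\<close> and \<open>B t\<close> are the sides of the rectangle of
    \<open>t\<close>. The product of their indicators keeps only the actual transcript in the sum
    over \<open>t\<close>.\<close>
  have AB: "A t x \<and> B t y \<longleftrightarrow> t = transcript p x y" for t x y
    unfolding A_def B_def using transcript_rectangle by metis
  have "M $ x $ y = (\<Sum>(t, i)\<in>?T \<times> {..<r}. (of_bool (A t x) * u t i x) * (of_bool (B t y) * v t i y))"
    for x y
  proof -
    have "(\<Sum>(t, i)\<in>?T \<times> {..<r}. (of_bool (A t x) * u t i x) * (of_bool (B t y) * v t i y))
        = (\<Sum>t\<in>?T. \<Sum>i<r. of_bool (A t x \<and> B t y) * (u t i x * v t i y))"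
      unfolding sum.cartesian_product by (intro sum.cong) auto
    also have "\<dots> = (\<Sum>t\<in>?T. if t = transcript p x y then \<Sum>i<r. u t i x * v t i y else 0)"
      unfolding AB by (intro sum.cong) auto
    also have "\<dots> = M $ x $ y"
      by (auto simp: M sum.delta)
    finally show ?thesis
      by simp
  qed
  then have "rank M \<le> card (?T \<times> {..<r})"
    by (intro rank_sum_outer_le[where u = "\<lambda>(t, i) x. of_bool (A t x) * u t i x"
          and v = "\<lambda>(t, i) y. of_bool (B t y) * v t i y"]) (auto simp: case_prod_unfold)
  also have "\<dots> \<le> r * 2 ^ cost p"
    using card_range_transcript_le[of p] by (simp add: card_cartesian_product)
  finally show ?thesis .
qed

text \<open>The case \<open>n = 0\<close> holds because \<open>log 2 0 = 0\<close>.\<close>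

lemma log2_le_of_le_mult_power:
  assumes "n \<le> r * 2 ^ c" and "r > 0"
  shows "log 2 (real n) \<le> log 2 (real r) + real c"
proof (cases "n = 0")
  case True
  then show ?thesis
    using assms(2) by (simp add: log_def)
next
  case False
  have "log 2 (real n) \<le> log 2 (real r * 2 ^ c)"
    using assms(1) False by (subst log_le_cancel_iff) (auto simp flip: of_nat_le_iff[where ?'a = real])
  also have "\<dots> = log 2 (real r) + real c"
    using assms(2) by (simp add: log_mult log_nat_power)
  finally show ?thesis .
qed

section \<open>Rank bounds in the three output models\<close>

text \<open>This makes a matrix entry linear in the output bits, so that the split and XOR models
  can be treated position by position.\<close>

lemma real_bits_to_nat:
  "real (bits_to_nat s) = (\<Sum>i<length s. of_bool (s ! i) * 2 ^ (length s - Suc i))"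
proof -
  have "real (bits_to_nat s) = (\<Sum>i<length s. of_bool (rev s ! i) * 2 ^ i)"
    by (simp add: bits_to_nat_def horner_sum_eq_sum atLeast0LessThan)
  also have "\<dots> = (\<Sum>i<length s. of_bool (rev s ! (length s - Suc i)) * 2 ^ (length s - Suc i))"
    by (rule sum.nat_diff_reindex[symmetric])
  also have "\<dots> = (\<Sum>i<length s. of_bool (s ! i) * 2 ^ (length s - Suc i))"
    by (intro sum.cong) (auto simp: rev_nth)
  finally show ?thesis .
qed

lemma rank_le_oot_model:
  assumes "oot_model f p"
  shows "rank (comm_matrix f) \<le> 2 ^ cost p"
proof -
  obtain outA outB where out: "\<And>x y. (outA (transcript p x y) x, outB (transcript p x y) y)
       \<in> {(Some (f x y), None), (None, Some (f x y))}"
    using assms unfolding oot_model_def by blast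
  \<comment> \<open>\<open>S t\<close> says that Alice answers somewhere on the rectangle of
    \<open>t\<close>; it decides which factor carries the value, the other being 1.\<close>
  define S where "S t \<longleftrightarrow> (\<exists>x y. transcript p x y = t \<and> outA t x \<noteq> None)" for t
  define u where "u t i x = (if S t then real (bits_to_nat (the (outA t x))) else 1)" for t x and i :: nat
  define v where "v t i y = (if S t then 1 else real (bits_to_nat (the (outB t y))))" for t y and i :: nat
  have "comm_matrix f $ x $ y = (\<Sum>i<1. u (transcript p x y) i x * v (transcript p x y) i y)" for x y
  proof (cases "S (transcript p x y)")
    case True
    then obtain x' y' where "transcript p x' y' = transcript p x y"
      and A: "outA (transcript p x y) x' \<noteq> None"
      unfolding S_def by blast
    \<comment> \<open>At \<open>(x', y)\<close> Alice answers, so Bob is silent. His output depends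
      only on \<open>t\<close> and \<open>y\<close>, so he is silent at \<open>(x, y)\<close> too,
      and Alice must answer there.\<close>
    then have "transcript p x' y = transcript p x y"
      using transcript_rectangle by metis
    then have "outB (transcript p x y) y = None"
      using out[of x' y] A by auto
    then have "outA (transcript p x y) x = Some (f x y)"
      using out[of x y] by auto
    then show ?thesis
      using True by (simp add: u_def v_def comm_matrix_def)
  next
    case False
    then have "outA (transcript p x y) x = None"
      unfolding S_def by blast
    then have "outB (transcript p x y) y = Some (f x y)"
      using out[of x y] by auto
    then show ?thesis
      using False by (simp add: u_def v_def comm_matrix_def)
  qed
  then have "rank (comm_matrix f) \<le> 1 * 2 ^ cost p"
    by (rule rank_protocol_le)
  then show ?thesis
    by simp
qed

text \<open>A weave yields a bit only if exactly one side is not \<open>None\<close>, so the silent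
  side adds 0.\<close>

lemma weave_bit_eq_Some:
  assumes "weave_bit a b = Some c"
  shows "of_bool c = (of_bool (a = Some True) + of_bool (b = Some True) :: real)"
  using assms by (cases "(a, b)" rule: weave_bit.cases) auto

lemma rank_le_split_model:
  assumes len: "\<And>x y. length (f x y) = k" and p: "split_model k f p"
  shows "rank (comm_matrix f) \<le> 2 * 2 ^ cost p"
proof -
  obtain outA outB where lA: "\<And>t x. length (outA t x) = k" and lB: "\<And>t y. length (outB t y) = k"
    and out: "\<And>x y. map2 weave_bit (outA (transcript p x y) x) (outB (transcript p x y) y)
        = map Some (f x y)"
    using p unfolding split_model_def by blast
  define w :: "bool option list \<Rightarrow> real"
    where "w s = (\<Sum>i<k. of_bool (s ! i = Some True) * 2 ^ (k - Suc i))" for s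
  \<comment> \<open>Term 0 is Alice's number times 1, and term 1 is 1 times Bob's, with
    \<open>*\<close> counted as 0 by \<open>w\<close>.\<close>
  define u where "u t i x = (if i = 0 then w (outA t x) else 1)" for t x and i :: nat
  define v where "v t i y = (if i = 0 then 1 else w (outB t y))" for t y and i :: nat
  have "comm_matrix f $ x $ y = (\<Sum>i<2. u (transcript p x y) i x * v (transcript p x y) i y)" for x y
  proof -
    let ?a = "outA (transcript p x y) x" and ?b = "outB (transcript p x y) y"
    have bit: "of_bool (f x y ! i) = (of_bool (?a ! i = Some True) + of_bool (?b ! i = Some True) :: real)"
      if "i < k" for i
    proof (rule weave_bit_eq_Some)
      have "map2 weave_bit ?a ?b ! i = map Some (f x y) ! i"
        by (simp only: out)
      then show "weave_bit (?a ! i) (?b ! i) = Some (f x y ! i)"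
        using that by (simp add: lA lB len)
    qed
    have "comm_matrix f $ x $ y = w ?a + w ?b"
      unfolding w_def comm_matrix_def vec_lambda_beta real_bits_to_nat len sum.distrib[symmetric]
      by (intro sum.cong) (auto simp: bit distrib_right)
    then show ?thesis
      by (simp add: u_def v_def numeral_2_eq_2)
  qed
  then show ?thesis
    by (rule rank_protocol_le)
qed

lemma rank_le_xor_model:
  fixes f :: "'a::finite \<Rightarrow> 'b::finite \<Rightarrow> bool list"
  assumes len: "\<And>x y. length (f x y) = k" and p: "xor_model k f p"
  shows "rank (comm_matrix f) \<le> (k + 1) * 2 ^ cost p"
proof -
  obtain outA :: "bool list \<Rightarrow> 'a \<Rightarrow> bool list" and outB :: "bool list \<Rightarrow> 'b \<Rightarrow> bool list"
    where lA: "\<And>t x. length (outA t x) = k" and lB: "\<And>t y. length (outB t y) = k"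
    and out: "\<And>x y. map2 (\<noteq>) (outA (transcript p x y) x) (outB (transcript p x y) y) = f x y"
    using p unfolding xor_model_def by blast
  \<comment> \<open>Half the weight of position \<open>i\<close>, by the factor 1/2 in the identity
    for XOR.\<close>
  define c :: "nat \<Rightarrow> real" where "c i = 2 ^ (k - Suc i) / 2" for i
  \<comment> \<open>Index \<open>k\<close> collects the constants of all positions into a single
    product.\<close>
  define u where "u t i x = (if i < k then - c i * (1 - 2 * of_bool (outA t x ! i)) else \<Sum>j<k. c j)"
    for t x i
  define v :: "bool list \<Rightarrow> nat \<Rightarrow> 'b \<Rightarrow> real"
    where "v t i y = (if i < k then 1 - 2 * of_bool (outB t y ! i) else 1)" for t y i
  have "comm_matrix f $ x $ y = (\<Sum>i<k + 1. u (transcript p x y) i x * v (transcript p x y) i y)" for x y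
  proof -
    let ?a = "outA (transcript p x y) x" and ?b = "outB (transcript p x y) y"
    have bit: "f x y ! i = (?a ! i \<noteq> ?b ! i)" if "i < k" for i
      using that by (simp add: lA lB flip: out)
    have "comm_matrix f $ x $ y
        = (\<Sum>i<k. - c i * (1 - 2 * of_bool (?a ! i)) * (1 - 2 * of_bool (?b ! i)) + c i)"
      unfolding comm_matrix_def vec_lambda_beta real_bits_to_nat len
      by (intro sum.cong) (auto simp: bit c_def)
    also have "\<dots> = (\<Sum>i<k. u (transcript p x y) i x * v (transcript p x y) i y) + (\<Sum>j<k. c j)"
      unfolding sum.distrib by (simp add: u_def v_def)
    finally show ?thesis
      by (simp add: u_def v_def)
  qed
  then show ?thesis
    by (rule rank_protocol_le)
qed

section \<open>Attained minima and existence of protocols\<close>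

text \<open>\<open>LEAST\<close> says nothing about an empty set of costs, hence the witness
  \<open>p\<close>.\<close>

lemma min_cost_attained:
  assumes "P p"
  obtains q where "P q" and "cost q = min_cost P"
proof -
  have "\<exists>q. P q \<and> cost q = min_cost P"
    unfolding min_cost_def by (rule LeastI[where k = "cost p"]) (use assms in blast)
  then show ?thesis
    using that by blast
qed

lemma min_cost_le: "P p \<Longrightarrow> min_cost P \<le> cost p"
  unfolding min_cost_def by (rule Least_le) blast

lemma min_cost_mono:
  assumes "P p" and "\<And>q. P q \<Longrightarrow> Q q"
  shows "min_cost Q \<le> min_cost P"
  by (metis assms min_cost_attained min_cost_le)

text \<open>Alice announces her input by one equality test per list entry. Both children are the
  same protocol, so no answer affects what follows.\<close>

lemma alice_sends:
  "\<exists>p. \<forall>x y. transcript p x y = map (\<lambda>a. x = a) as @ transcript q x y"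
proof (induction as)
  case Nil
  show ?case
    by (rule exI[of _ q]) simp
next
  case (Cons a as)
  then obtain p where "\<forall>x y. transcript p x y = map (\<lambda>a. x = a) as @ transcript q x y"
    by blast
  then show ?case
    by (intro exI[of _ "Alice (\<lambda>x. x = a) p p"]) simp
qed

lemma bob_sends:
  "\<exists>p :: ('a, 'b) protocol. \<forall>x y. transcript p x y = map (\<lambda>b. y = b) bs"
proof (induction bs)
  case Nil
  show ?case
    by (rule exI[of _ Leaf]) simp
next
  case (Cons b bs)
  then obtain p :: "('a, 'b) protocol" where "\<forall>x y. transcript p x y = map (\<lambda>b. y = b) bs"
    by blast
  then show ?case
    by (intro exI[of _ "Bob (\<lambda>y. y = b) p p"]) simp
qed

text \<open>Both players announce their inputs, so the transcript determines the pair.\<close>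

lemma open_model_exists:
  fixes f :: "'a::finite \<Rightarrow> 'b::finite \<Rightarrow> bool list"
  shows "\<exists>p. open_model f p"
proof -
  obtain as :: "'a list" where as: "set as = UNIV"
    using finite_list[OF finite] by blast
  obtain bs :: "'b list" where bs: "set bs = UNIV"
    using finite_list[OF finite] by blast
  obtain p where p: "\<And>x y. transcript p x y = map (\<lambda>a. x = a) as @ map (\<lambda>b. y = b) bs"
    using alice_sends bob_sends by metis
  have determined: "x = x' \<and> y = y'" if "transcript p x y = transcript p x' y'" for x x' y y'
    using that as bs by (auto simp: p)
  define out where "out t = (SOME s. \<exists>x y. transcript p x y = t \<and> s = f x y)" for t
  have "out (transcript p x y) = f x y" for x y
    unfolding out_def by (rule some_equality) (use determined in blast)+
  then show ?thesis
    unfolding open_model_def by blast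
qed

section \<open>Relations between the output models\<close>

lemma open_model_eq_local_model: "open_model f = local_model f"
proof (intro ext iffI)
  fix p
  assume "open_model f p"
  then obtain out where "\<And>x y. out (transcript p x y) = f x y"
    unfolding open_model_def by blast
  then show "local_model f p"
    unfolding local_model_def by (intro exI[of _ "\<lambda>t _. out t"]) simp
next
  fix p
  assume "local_model f p"
  then obtain outA outB where A: "\<And>x y. outA (transcript p x y) x = f x y"
    and B: "\<And>x y. outB (transcript p x y) y = f x y"
    unfolding local_model_def by blast
  \<comment> \<open>Pass through \<open>(x, y')\<close>: Alice's output does not see the change of
    \<open>y\<close>, nor Bob's the change of \<open>x\<close>.\<close>
  have const: "f x y = f x' y'" if "transcript p x y = transcript p x' y'" for x y x' y'
    by (metis A B that transcript_rectangle)
  define out where "out t = (SOME s. \<exists>x y. transcript p x y = t \<and> s = f x y)" for t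
  have "out (transcript p x y) = f x y" for x y
    unfolding out_def by (rule some_equality) (use const in blast)+
  then show "open_model f p"
    unfolding open_model_def by blast
qed

lemma local_model_imp_alice_model: "local_model f p \<Longrightarrow> alice_model f p"
  unfolding local_model_def alice_model_def by blast

lemma local_model_imp_bob_model: "local_model f p \<Longrightarrow> bob_model f p"
  unfolding local_model_def bob_model_def by blast

lemma alice_model_imp_oot_model:
  assumes "alice_model f p"
  shows "oot_model f p"
proof -
  obtain outA where "\<And>x y. outA (transcript p x y) x = f x y"
    using assms unfolding alice_model_def by blast
  then show ?thesis
    unfolding oot_model_def
    by (intro exI[of _ "\<lambda>t x. Some (outA t x)"] exI[of _ "\<lambda>t y. None"]) simp
qed

lemma bob_model_imp_oot_model:
  assumes "bob_model f p"
  shows "oot_model f p"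
proof -
  obtain outB where "\<And>x y. outB (transcript p x y) y = f x y"
    using assms unfolding bob_model_def by blast
  then show ?thesis
    unfolding oot_model_def
    by (intro exI[of _ "\<lambda>t x. None"] exI[of _ "\<lambda>t y. Some (outB t y)"]) simp
qed

text \<open>Off the reachable transcripts the output is padded, because the split and XOR models ask for
  length \<open>k\<close> everywhere.\<close>

lemma open_model_out_length:
  assumes "\<And>x y. length (f x y) = k" and "open_model f p"
  obtains out where "\<And>t. length (out t) = k" and "\<And>x y. out (transcript p x y) = f x y"
proof -
  obtain out where "\<And>x y. out (transcript p x y) = f x y"
    using assms(2) unfolding open_model_def by blast
  with assms(1) show ?thesis
    by (intro that[of "\<lambda>t. if length (out t) = k then out t else replicate k False"]) auto
qed

text \<open>Alice gives every position and Bob none. This provides the witness that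
  \<open>D_spt\<close> is attained.\<close>

lemma open_model_imp_split_model:
  assumes "\<And>x y. length (f x y) = k" and "open_model f p"
  shows "split_model k f p"
proof -
  obtain out where out: "\<And>t. length (out t) = k" "\<And>x y. out (transcript p x y) = f x y"
    using open_model_out_length assms by blast
  then show ?thesis
    unfolding split_model_def
    by (intro exI[of _ "\<lambda>t x. map Some (out t)"] exI[of _ "\<lambda>t y. replicate k None"])
      (auto simp: list_eq_iff_nth_eq assms(1))
qed

lemma open_model_imp_xor_model:
  assumes "\<And>x y. length (f x y) = k" and "open_model f p"
  shows "xor_model k f p"
proof -
  obtain out where out: "\<And>t. length (out t) = k" "\<And>x y. out (transcript p x y) = f x y"
    using open_model_out_length assms by blast
  then show ?thesis
    unfolding xor_model_def
    by (intro exI[of _ "\<lambda>t x. out t"] exI[of _ "\<lambda>t y. replicate k False"])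
      (auto simp: list_eq_iff_nth_eq assms(1))
qed

theorem mainTheorem4:
  fixes f :: "'a::finite \<Rightarrow> 'b::finite \<Rightarrow> bool list" and k :: nat
  assumes "\<And>x y. length (f x y) = k"
  shows "D_op f = D_loc f
    \<and> D_loc f \<ge> D_uni f
    \<and> D_uni f \<ge> D_oot f
    \<and> real (D_oot f) \<ge> log 2 (real (rank (comm_matrix f)))
    \<and> real (D_spt k f) \<ge> log 2 (real (rank (comm_matrix f))) - 1
    \<and> real (D_xor k f) \<ge> log 2 (real (rank (comm_matrix f))) - log 2 (real k + 1)"
proof (intro conjI)
  obtain p where p: "open_model f p"
    using open_model_exists by blast
  then have loc: "local_model f p"
    by (simp add: open_model_eq_local_model)
  show "D_op f = D_loc f"
    by (simp add: D_op_def D_loc_def open_model_eq_local_model)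
  have "D_A f \<le> D_loc f"
    unfolding D_A_def D_loc_def
    using loc local_model_imp_alice_model by (rule min_cost_mono)
  then show "D_uni f \<le> D_loc f"
    by (simp add: D_uni_def)
  have "D_oot f \<le> D_A f"
    unfolding D_oot_def D_A_def
    using local_model_imp_alice_model[OF loc] alice_model_imp_oot_model by (rule min_cost_mono)
  moreover have "D_oot f \<le> D_B f"
    unfolding D_oot_def D_B_def
    using local_model_imp_bob_model[OF loc] bob_model_imp_oot_model by (rule min_cost_mono)
  ultimately show "D_oot f \<le> D_uni f"
    by (simp add: D_uni_def)
  \<comment> \<open>An optimal protocol is used in each model. The number of products per rectangle,
    1, 2 or \<open>k + 1\<close>, becomes the subtracted term 0, 1 or
    \<open>log 2 (k + 1)\<close>.\<close>
  obtain q where "oot_model f q" "cost q = D_oot f"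
    using min_cost_attained[where P = "oot_model f", OF alice_model_imp_oot_model[OF local_model_imp_alice_model[OF loc]]]
    unfolding D_oot_def by blast
  then show "log 2 (real (rank (comm_matrix f))) \<le> real (D_oot f)"
    using log2_le_of_le_mult_power[of "rank (comm_matrix f)" 1 "D_oot f"] rank_le_oot_model[of f q]
    by simp
  obtain q where "split_model k f q" "cost q = D_spt k f"
    using min_cost_attained[where P = "split_model k f", OF open_model_imp_split_model[OF assms p]]
    unfolding D_spt_def by blast
  then show "log 2 (real (rank (comm_matrix f))) - 1 \<le> real (D_spt k f)"
    using log2_le_of_le_mult_power[of "rank (comm_matrix f)" 2 "D_spt k f"]
      rank_le_split_model[OF assms, where p = q]
    by simp
  obtain q where "xor_model k f q" "cost q = D_xor k f"
    using min_cost_attained[where P = "xor_model k f", OF open_model_imp_xor_model[OF assms p]]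
    unfolding D_xor_def by blast
  then show "log 2 (real (rank (comm_matrix f))) - log 2 (real k + 1) \<le> real (D_xor k f)"
    using log2_le_of_le_mult_power[of "rank (comm_matrix f)" "k + 1" "D_xor k f"]
      rank_le_xor_model[OF assms, where p = q]
    by (simp add: add.commute)
qed

end
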